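(* Let $a>0$, let $\pi_0$ be the elicited prior density and $q\in Q$ a contaminating prior density, and for $0\le\epsilon\le 1$ let $$\pi(\theta)=\pi_\epsilon(\theta)=c(\epsilon)\,\pi_0^{1-\epsilon}(\theta)\,q^{\epsilon}(\theta),$$ with $c(\epsilon)$ the normalizing constant, be the corresponding member of the geometric contaminated class $\Gamma_g=\{\pi:\ \pi(\theta)=c(\epsilon)\pi_0^{1-\epsilon}(\theta)q^{\epsilon}(\theta),\ q\in Q\}$. Let $d=d(\epsilon)=d(\pi(\theta|x),\pi_0(\theta|x))$ be the R\'enyi divergence of order $a$ between the posterior density $\pi(\theta|x)$ under $\pi_\epsilon$ and the posterior density $\pi_0(\theta|x)$ under $\pi_0$. Then the local curvature of the R\'enyi divergence at $\epsilon=0$ is $$C_a^{\Gamma_g}=\frac{\partial^2 d}{\partial\epsilon^2}\bigg|_{\epsilon=0}=a\,\mathrm{Var}_{\pi_0(\theta|x)}\left[\ln\left(\frac{q(\theta)}{\pi_0(\theta)}\right)\right],$$ where $\mathrm{Var}_{\pi_0(\theta|x)}$ denotes the variance with respect to the density $\pi_0(\theta|x)$.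
   Context: A statistical model is given by densities $f_\theta(x)$ (with respect to some measure), $\theta\in\Theta$. The data $x$ is fixed. $Q$ is a class of probability densities on $\Theta$; $\pi_0$ and $q\in Q$ are fixed probability densities on $\Theta$, both strictly positive on $\Theta$ (so that $\ln(q/\pi_0)$ is defined). The normalizing constant is $c(\epsilon)=\left(\int \pi_0^{1-\epsilon}(\theta)q^{\epsilon}(\theta)\,d\theta\right)^{-1}$. For a prior density $\pi$ on $\Theta$, the prior predictive density is $m(x|\pi)=\int f_\theta(x)\pi(\theta)\,d\theta$ and the posterior density is $\pi(\theta|x)=f_\theta(x)\pi(\theta)/m(x|\pi)$. It is assumed that $0<m(x|\pi_0)<\infty$ and $0<m(x|q)<\infty$, so that the posteriors are defined. R\'enyi divergence of order $a>0$, $a\neq 1$, between posterior densities: $$d(\pi(\theta|x),\pi_0(\theta|x))=\frac{1}{a-1}\ln\left(\int (\pi(\theta|x))^a(\pi_0(\theta|x))^{1-a}\,d\theta\right).$$ For $a=1$ it is defined by the limit $a\to1$, i.e. the Kullback-Leibler divergence $\int \pi(\theta|x)\ln\frac{\pi(\theta|x)}{\pi_0(\theta|x)}\,d\theta$. All integrals over posteriors are taken over $\{\theta: f_\theta(x)>0\}$. Derivatives in $\epsilon$ at $\epsilon=0$ are understood as one-sided (right) derivatives, since $0\le\epsilon\le1$. Standing regularity assumption: for $\epsilon$ in some interval $[0,\epsilon_0)$ with $\epsilon_0>0$, the divergence is finite, the quantities involved (including $c(\epsilon)$, $m(x|\pi_\epsilon)$ and $\pi(\theta|x)$) are twice differentiable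 in $\epsilon$, and differentiation in $\epsilon$ (up to second order) may be interchanged with integration over $\theta$, namely in $\int f_\theta(x)\pi_0^{1-\epsilon}(\theta)q^{\epsilon}(\theta)\,d\theta$, in $\int \pi(\theta|x)\,d\theta$ and in $\int (\pi(\theta|x))^a(\pi_0(\theta|x))^{1-a}\,d\theta$ (for $a=1$, in $\int \pi(\theta|x)\ln(\pi(\theta|x)/\pi_0(\theta|x))\,d\theta$), all the resulting integrals being finite. *)

theory Defs
  imports "HOL-Probability.Probability"
begin

text \<open>
  The parameter space is \<open>space M\<close>, where \<open>M\<close> is the measure with respect to which priors and
  posteriors are densities (the measure \<open>d\<theta>\<close>). The model is \<open>f \<theta> x\<close>, with \<open>f \<theta>\<close> a density
  with respect to a measure \<open>N\<close> on the sample space.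
\<close>

definition prob_density :: "'a measure \<Rightarrow> ('a \<Rightarrow> real) \<Rightarrow> bool" where
  "prob_density M p \<longleftrightarrow>
     (\<forall>z\<in>space M. 0 \<le> p z) \<and> integrable M p \<and> (LINT z|M. p z) = 1"

definition prior_predictive ::
    "'t measure \<Rightarrow> ('t \<Rightarrow> 'x \<Rightarrow> real) \<Rightarrow> 'x \<Rightarrow> ('t \<Rightarrow> real) \<Rightarrow> real" where
  "prior_predictive M f x \<pi> = (LINT \<theta>|M. f \<theta> x * \<pi> \<theta>)"

definition posterior ::
    "'t measure \<Rightarrow> ('t \<Rightarrow> 'x \<Rightarrow> real) \<Rightarrow> 'x \<Rightarrow> ('t \<Rightarrow> real) \<Rightarrow> 't \<Rightarrow> real" where
  "posterior M f x \<pi> \<theta> = f \<theta> x * \<pi> \<theta> / prior_predictive M f x \<pi>"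

definition geom_const :: "'t measure \<Rightarrow> ('t \<Rightarrow> real) \<Rightarrow> ('t \<Rightarrow> real) \<Rightarrow> real \<Rightarrow> real" where
  "geom_const M \<pi>0 q \<epsilon> = inverse (LINT \<theta>|M. \<pi>0 \<theta> powr (1 - \<epsilon>) * q \<theta> powr \<epsilon>)"

definition geom_prior ::
    "'t measure \<Rightarrow> ('t \<Rightarrow> real) \<Rightarrow> ('t \<Rightarrow> real) \<Rightarrow> real \<Rightarrow> 't \<Rightarrow> real" where
  "geom_prior M \<pi>0 q \<epsilon> \<theta> = geom_const M \<pi>0 q \<epsilon> * \<pi>0 \<theta> powr (1 - \<epsilon>) * q \<theta> powr \<epsilon>"

definition likelihood_support ::
    "'t measure \<Rightarrow> ('t \<Rightarrow> 'x \<Rightarrow> real) \<Rightarrow> 'x \<Rightarrow> 't set" where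
  "likelihood_support M f x = {\<theta>\<in>space M. f \<theta> x > 0}"

text \<open>Order 1 is the Kullback--Leibler divergence.\<close>

definition renyi_integrand :: "real \<Rightarrow> ('t \<Rightarrow> real) \<Rightarrow> ('t \<Rightarrow> real) \<Rightarrow> 't \<Rightarrow> real" where
  "renyi_integrand a p r \<theta> =
     (if a = 1 then p \<theta> * ln (p \<theta> / r \<theta>) else p \<theta> powr a * r \<theta> powr (1 - a))"

definition renyi_divergence ::
    "'t measure \<Rightarrow> 't set \<Rightarrow> real \<Rightarrow> ('t \<Rightarrow> real) \<Rightarrow> ('t \<Rightarrow> real) \<Rightarrow> real" where
  "renyi_divergence M S a p r =
     (if a = 1 then (LINT \<theta>:S|M. renyi_integrand a p r \<theta>)
      else 1 / (a - 1) * ln (LINT \<theta>:S|M. renyi_integrand a p r \<theta>))"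

text \<open>
  Derivatives are taken within \<open>I\<close>. For \<open>I = {0..<\<epsilon>0}\<close> they are right derivatives at \<open>0\<close> and
  ordinary derivatives elsewhere.
\<close>

definition twice_differentiable_on :: "(real \<Rightarrow> real) \<Rightarrow> real set \<Rightarrow> bool" where
  "twice_differentiable_on g I \<longleftrightarrow>
     (\<exists>g' g''. \<forall>\<epsilon>\<in>I. (g has_real_derivative g' \<epsilon>) (at \<epsilon> within I) \<and>
                     (g' has_real_derivative g'' \<epsilon>) (at \<epsilon> within I))"

text \<open>
  Differentiation in \<open>\<epsilon> \<in> I\<close> up to second order may be interchanged with integration over \<open>S\<close>,
  all integrals being finite. The witnesses \<open>g'\<close> and \<open>g''\<close> are the pointwise derivatives on \<open>S\<close>.
\<close>

definition diff_under_integral2 ::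
    "'t measure \<Rightarrow> 't set \<Rightarrow> real set \<Rightarrow> (real \<Rightarrow> 't \<Rightarrow> real) \<Rightarrow> bool" where
  "diff_under_integral2 M S I g \<longleftrightarrow>
     (\<exists>g' g''. \<forall>\<epsilon>\<in>I.
        (\<forall>\<theta>\<in>S. ((\<lambda>e. g e \<theta>) has_real_derivative g' \<epsilon> \<theta>) (at \<epsilon> within I) \<and>
              ((\<lambda>e. g' e \<theta>) has_real_derivative g'' \<epsilon> \<theta>) (at \<epsilon> within I)) \<and>
        set_integrable M S (g \<epsilon>) \<and> set_integrable M S (g' \<epsilon>) \<and> set_integrable M S (g'' \<epsilon>) \<and>
        ((\<lambda>e. LINT \<theta>:S|M. g e \<theta>) has_real_derivative (LINT \<theta>:S|M. g' \<epsilon> \<theta>)) (at \<epsilon> within I) \<and>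
        ((\<lambda>e. LINT \<theta>:S|M. g' e \<theta>) has_real_derivative (LINT \<theta>:S|M. g'' \<epsilon> \<theta>)) (at \<epsilon> within I))"

text \<open>
  The standing regularity assumption. Finiteness of the divergence is the integrability of
  \<open>renyi_integrand\<close> contained in the last conjunct.
\<close>

definition geom_regular ::
    "'t measure \<Rightarrow> ('t \<Rightarrow> 'x \<Rightarrow> real) \<Rightarrow> 'x \<Rightarrow> ('t \<Rightarrow> real) \<Rightarrow> ('t \<Rightarrow> real) \<Rightarrow> real \<Rightarrow> real set \<Rightarrow> bool"
  where
  "geom_regular M f x \<pi>0 q a I \<longleftrightarrow>
     twice_differentiable_on (geom_const M \<pi>0 q) I \<and>
     twice_differentiable_on (\<lambda>\<epsilon>. prior_predictive M f x (geom_prior M \<pi>0 q \<epsilon>)) I \<and>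
     (\<forall>\<theta>\<in>space M. twice_differentiable_on (\<lambda>\<epsilon>. posterior M f x (geom_prior M \<pi>0 q \<epsilon>) \<theta>) I) \<and>
     diff_under_integral2 M (space M) I (\<lambda>\<epsilon> \<theta>. f \<theta> x * \<pi>0 \<theta> powr (1 - \<epsilon>) * q \<theta> powr \<epsilon>) \<and>
     diff_under_integral2 M (likelihood_support M f x) I
       (\<lambda>\<epsilon>. posterior M f x (geom_prior M \<pi>0 q \<epsilon>)) \<and>
     diff_under_integral2 M (likelihood_support M f x) I
       (\<lambda>\<epsilon>. renyi_integrand a (posterior M f x (geom_prior M \<pi>0 q \<epsilon>)) (posterior M f x \<pi>0))"

text \<open>\<open>D\<close> is the (unique) second derivative of \<open>g\<close> at \<open>t\<close> from the right.\<close>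

definition has_right_second_derivative :: "(real \<Rightarrow> real) \<Rightarrow> real \<Rightarrow> real \<Rightarrow> bool" where
  "has_right_second_derivative g D t \<longleftrightarrow>
     (\<exists>\<delta>>0. \<exists>g'.
        (\<forall>s\<in>{t..<t + \<delta>}. (g has_real_derivative g' s) (at s within {t..<t + \<delta>})) \<and>
        (g' has_real_derivative D) (at t within {t..<t + \<delta>}))"

end

theory Submission
  imports Defs
begin

text \<open>
  Write \<open>L = ln (q / \<pi>0)\<close> and \<open>Z \<epsilon> = LINT \<theta>|M. f \<theta> x * \<pi>0 \<theta> powr (1 - \<epsilon>) * q \<theta> powr \<epsilon>\<close>. The constant
  \<open>c(\<epsilon>)\<close> cancels in the posterior, which is therefore the exponential tilt \<open>p0 * exp (\<epsilon> * L - K \<epsilon>)\<close>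
  of the posterior \<open>p0\<close> under \<open>\<pi>0\<close>, where \<open>K \<epsilon> = ln (Z \<epsilon>) - ln (Z 0)\<close> is the cumulant generating
  function of \<open>L\<close> under \<open>p0\<close>; so \<open>K' 0\<close> and \<open>K'' 0\<close> are the mean and the variance of \<open>L\<close>.
  For every order the integrand of the divergence has the form \<open>p0 * F (\<epsilon> * L - K \<epsilon>)\<close>, with
  \<open>F t = exp (a * t)\<close> for \<open>a \<noteq> 1\<close> and \<open>F t = t * exp t\<close> for \<open>a = 1\<close>. Its integral has first
  derivative \<open>0\<close> and second derivative \<open>(F'' 0 - F' 0) * K'' 0\<close> at \<open>\<epsilon> = 0\<close>.
\<close>

section \<open>Derivatives on a half-open interval and integrals over a set\<close>

lemma at_within_atLeastLessThan_neq_bot: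
  fixes s e :: real
  assumes "s \<in> {t..<e}"
  shows "at s within {t..<e} \<noteq> bot"
proof -
  have "at_right s \<noteq> bot" by simp
  \<comment> \<open>Every point of the interval, its left end included, is approached from the right
    inside it. Hence derivatives within the interval are unique, which later identifies existential
    witnesses.\<close>
  moreover have "at_right s = at s within {s<..<e}"
    using assms by (intro at_within_nhd[where S="{..<e}"]) auto
  moreover have "at s within {s<..<e} \<le> at s within {t..<e}"
    using assms by (intro at_le) auto
  ultimately show ?thesis by (metis bot.extremum_unique)
qed

lemma set_integrable_space:
  fixes g :: "'a \<Rightarrow> real"
  shows "set_integrable M (space M) g \<longleftrightarrow> integrable M g"
  unfolding set_integrable_def by (rule Bochner_Integration.integrable_cong) auto

text \<open>The function \<open>h\<close> certifies that \<open>S\<close> is not a null set: if the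
  integral of \<open>g\<close> vanished, \<open>g\<close> would vanish almost everywhere, so almost
  no point would lie in \<open>S\<close> and every integral over \<open>S\<close> would be
  0.\<close>

lemma set_integral_pos:
  fixes g h :: "'a \<Rightarrow> real"
  assumes g: "set_integrable M S g" "\<And>\<theta>. \<theta> \<in> S \<Longrightarrow> \<theta> \<in> space M \<Longrightarrow> 0 < g \<theta>"
    and h: "(LINT \<theta>:S|M. h \<theta>) \<noteq> 0"
  shows "0 < (LINT \<theta>:S|M. g \<theta>)"
proof (rule ccontr)
  let ?g = "\<lambda>\<theta>. indicator S \<theta> *\<^sub>R g \<theta>"
  assume "\<not> ?thesis"
  moreover have nn: "AE \<theta> in M. 0 \<le> ?g \<theta>"
    by (intro AE_I2) (auto simp: indicator_def less_imp_le[OF g(2)])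
  ultimately have "integral\<^sup>L M ?g = 0"
    using integral_nonneg_AE[OF nn] by (simp add: set_lebesgue_integral_def)
  then have "AE \<theta> in M. ?g \<theta> = 0"
    using integral_nonneg_eq_0_iff_AE[OF _ nn] g(1) by (simp add: set_integrable_def)
  then have "AE \<theta> in M. indicator S \<theta> *\<^sub>R h \<theta> = 0"
    using AE_space by eventually_elim (use g(2) in \<open>force simp: indicator_def\<close>)
  then have "(LINT \<theta>:S|M. h \<theta>) = 0"
    unfolding set_lebesgue_integral_def by (rule integral_eq_zero_AE)
  with h show False by simp
qed

text \<open>\<open>diff_under_integral2\<close> only asserts that some pointwise derivatives exist.
  Uniqueness of derivatives forces them to agree on \<open>S\<close> with any formulas computed by
  calculus, so integrability and interchange carry over to those formulas.\<close>

lemma diff_under_integral2_explicit: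
  fixes g h h' h'' :: "real \<Rightarrow> 'a \<Rightarrow> real"
  assumes g: "diff_under_integral2 M S {0..<e} g"
    and eq: "\<And>\<epsilon> \<theta>. \<epsilon> \<in> {0..<e} \<Longrightarrow> \<theta> \<in> S \<Longrightarrow> g \<epsilon> \<theta> = h \<epsilon> \<theta>"
    and h': "\<And>\<epsilon> \<theta>. \<epsilon> \<in> {0..<e} \<Longrightarrow> \<theta> \<in> S \<Longrightarrow>
      ((\<lambda>e. h e \<theta>) has_real_derivative h' \<epsilon> \<theta>) (at \<epsilon> within {0..<e})"
    and h'': "\<And>\<epsilon> \<theta>. \<epsilon> \<in> {0..<e} \<Longrightarrow> \<theta> \<in> S \<Longrightarrow>
      ((\<lambda>e. h' e \<theta>) has_real_derivative h'' \<epsilon> \<theta>) (at \<epsilon> within {0..<e})"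
    and eps: "\<epsilon> \<in> {0..<e}"
  shows "set_integrable M S (h \<epsilon>)" "set_integrable M S (h' \<epsilon>)" "set_integrable M S (h'' \<epsilon>)"
    and "((\<lambda>e. LINT \<theta>:S|M. h e \<theta>) has_real_derivative (LINT \<theta>:S|M. h' \<epsilon> \<theta>)) (at \<epsilon> within {0..<e})"
    and "((\<lambda>e. LINT \<theta>:S|M. h' e \<theta>) has_real_derivative (LINT \<theta>:S|M. h'' \<epsilon> \<theta>)) (at \<epsilon> within {0..<e})"
proof -
  obtain g' g'' where w: "\<And>\<epsilon>. \<epsilon> \<in> {0..<e} \<Longrightarrow>
        (\<forall>\<theta>\<in>S. ((\<lambda>e. g e \<theta>) has_real_derivative g' \<epsilon> \<theta>) (at \<epsilon> within {0..<e}) \<and>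
              ((\<lambda>e. g' e \<theta>) has_real_derivative g'' \<epsilon> \<theta>) (at \<epsilon> within {0..<e})) \<and>
        set_integrable M S (g \<epsilon>) \<and> set_integrable M S (g' \<epsilon>) \<and> set_integrable M S (g'' \<epsilon>) \<and>
        ((\<lambda>e. LINT \<theta>:S|M. g e \<theta>) has_real_derivative (LINT \<theta>:S|M. g' \<epsilon> \<theta>)) (at \<epsilon> within {0..<e}) \<and>
        ((\<lambda>e. LINT \<theta>:S|M. g' e \<theta>) has_real_derivative (LINT \<theta>:S|M. g'' \<epsilon> \<theta>)) (at \<epsilon> within {0..<e})"
    using g unfolding diff_under_integral2_def by blast
  have eq': "g' \<epsilon> \<theta> = h' \<epsilon> \<theta>" if i: "\<epsilon> \<in> {0..<e}" and s: "\<theta> \<in> S" for \<epsilon> \<theta>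
  proof -
    have "((\<lambda>e. g e \<theta>) has_real_derivative h' \<epsilon> \<theta>) (at \<epsilon> within {0..<e})"
      \<comment> \<open>The radius 1 is arbitrary, since the two functions agree on the whole
        interval.\<close>
      using h'[OF i s] by (rule has_field_derivative_transform_within[where d=1]) (use i s eq in auto)
    with w[OF i] s show ?thesis
      using has_field_derivative_unique at_within_atLeastLessThan_neq_bot[OF i] by blast
  qed
  \<comment> \<open>The equality of the first derivatives holds throughout the interval, so it may
    itself be differentiated.\<close>
  have eq'': "g'' \<epsilon> \<theta> = h'' \<epsilon> \<theta>" if i: "\<epsilon> \<in> {0..<e}" and s: "\<theta> \<in> S" for \<epsilon> \<theta>
  proof -
    have "((\<lambda>e. g' e \<theta>) has_real_derivative h'' \<epsilon> \<theta>) (at \<epsilon> within {0..<e})"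
      using h''[OF i s] by (rule has_field_derivative_transform_within[where d=1]) (use i s eq' in auto)
    with w[OF i] s show ?thesis
      using has_field_derivative_unique at_within_atLeastLessThan_neq_bot[OF i] by blast
  qed
  have ind: "(\<lambda>\<theta>. indicator S \<theta> *\<^sub>R u \<theta>) = (\<lambda>\<theta>. indicator S \<theta> *\<^sub>R v \<theta>)"
    if "\<And>\<theta>. \<theta> \<in> S \<Longrightarrow> u \<theta> = v \<theta>" for u v :: "'a \<Rightarrow> real"
    using that by (auto simp: indicator_def)
  have cong: "set_integrable M S u = set_integrable M S v" "(LINT \<theta>:S|M. u \<theta>) = (LINT \<theta>:S|M. v \<theta>)"
    if "\<And>\<theta>. \<theta> \<in> S \<Longrightarrow> u \<theta> = v \<theta>" for u v :: "'a \<Rightarrow> real"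
    using ind[OF that] by (simp_all add: set_integrable_def set_lebesgue_integral_def)
  note W = w[OF eps]
  show "set_integrable M S (h \<epsilon>)" "set_integrable M S (h' \<epsilon>)" "set_integrable M S (h'' \<epsilon>)"
    using W cong(1)[OF eq[OF eps]] cong(1)[OF eq'[OF eps]] cong(1)[OF eq''[OF eps]] by auto
  have "((\<lambda>e. LINT \<theta>:S|M. g e \<theta>) has_real_derivative (LINT \<theta>:S|M. h' \<epsilon> \<theta>)) (at \<epsilon> within {0..<e})"
    using W cong(2)[OF eq'[OF eps]] by simp
  then show "((\<lambda>e. LINT \<theta>:S|M. h e \<theta>) has_real_derivative (LINT \<theta>:S|M. h' \<epsilon> \<theta>)) (at \<epsilon> within {0..<e})"
    by (rule has_field_derivative_transform_within[where d=1]) (use eps cong(2)[OF eq] in auto)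
  have "((\<lambda>e. LINT \<theta>:S|M. g' e \<theta>) has_real_derivative (LINT \<theta>:S|M. h'' \<epsilon> \<theta>)) (at \<epsilon> within {0..<e})"
    using W cong(2)[OF eq''[OF eps]] by simp
  then show "((\<lambda>e. LINT \<theta>:S|M. h' e \<theta>) has_real_derivative (LINT \<theta>:S|M. h'' \<epsilon> \<theta>)) (at \<epsilon> within {0..<e})"
    by (rule has_field_derivative_transform_within[where d=1]) (use eps cong(2)[OF eq'] in auto)
qed

section \<open>Second derivatives of logarithms and of integrals of tilted densities\<close>

lemma ln_second_derivative:
  fixes Z Z1 :: "real \<Rightarrow> real"
  assumes "0 < Z t" "(Z has_real_derivative Z1 t) (at t within I)"
    and "(Z1 has_real_derivative z2) (at t within I)"
  shows "((\<lambda>s. ln (Z s)) has_real_derivative Z1 t / Z t) (at t within I)"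
    and "((\<lambda>s. Z1 s / Z s) has_real_derivative z2 / Z t - (Z1 t / Z t)\<^sup>2) (at t within I)"
  using assms by (auto intro!: derivative_eq_intros simp: field_simps power2_eq_square)

text \<open>At 0 the argument of \<open>F\<close> is 0 for every parameter, so \<open>F1\<close> and
  \<open>F2\<close> leave the integral as the constants \<open>F1 0\<close> and \<open>F2 0\<close>.
  What remains is moments of \<open>L\<close> up to order two, which the hypotheses express through
  \<open>K1 0\<close> and \<open>K2 0\<close>.\<close>

lemma integral_tilted_second_derivative:
  fixes p L :: "'a \<Rightarrow> real" and K K1 K2 F F1 F2 :: "real \<Rightarrow> real"
  assumes e: "0 < e"
    and g: "diff_under_integral2 M S {0..<e} g"
    and eq: "\<And>\<epsilon> \<theta>. \<epsilon> \<in> {0..<e} \<Longrightarrow> \<theta> \<in> S \<Longrightarrow> g \<epsilon> \<theta> = p \<theta> * F (\<epsilon> * L \<theta> - K \<epsilon>)"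
    and F: "\<And>t. (F has_real_derivative F1 t) (at t)" "\<And>t. (F1 has_real_derivative F2 t) (at t)"
    and K: "\<And>\<epsilon>. \<epsilon> \<in> {0..<e} \<Longrightarrow> (K has_real_derivative K1 \<epsilon>) (at \<epsilon> within {0..<e})"
      "\<And>\<epsilon>. \<epsilon> \<in> {0..<e} \<Longrightarrow> (K1 has_real_derivative K2 \<epsilon>) (at \<epsilon> within {0..<e})"
    and K0: "K 0 = 0"
    and p: "set_integrable M S p" "(LINT \<theta>:S|M. p \<theta>) = 1"
    and pL: "set_integrable M S (\<lambda>\<theta>. p \<theta> * L \<theta>)" "(LINT \<theta>:S|M. p \<theta> * L \<theta>) = K1 0"
    and pLL: "set_integrable M S (\<lambda>\<theta>. p \<theta> * (L \<theta>)\<^sup>2)"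
      "(LINT \<theta>:S|M. p \<theta> * (L \<theta>)\<^sup>2) = K2 0 + (K1 0)\<^sup>2"
  obtains G1 where
    "\<And>\<epsilon>. \<epsilon> \<in> {0..<e} \<Longrightarrow> set_integrable M S (g \<epsilon>)"
    "\<And>\<epsilon>. \<epsilon> \<in> {0..<e} \<Longrightarrow>
      ((\<lambda>\<epsilon>. LINT \<theta>:S|M. g \<epsilon> \<theta>) has_real_derivative G1 \<epsilon>) (at \<epsilon> within {0..<e})"
    "(G1 has_real_derivative (F2 0 - F1 0) * K2 0) (at 0 within {0..<e})"
    "(LINT \<theta>:S|M. g 0 \<theta>) = F 0" "G1 0 = 0"
proof
  let ?\<psi> = "\<lambda>\<epsilon> \<theta>. \<epsilon> * L \<theta> - K \<epsilon>"
  \<comment> \<open>These come from the chain rule: the inner function has first derivative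
    \<open>L \<theta> - K1 \<epsilon>\<close> and second derivative
    \<open>- K2 \<epsilon>\<close>.\<close>
  define h1 where "h1 = (\<lambda>\<epsilon> \<theta>. p \<theta> * (F1 (?\<psi> \<epsilon> \<theta>) * (L \<theta> - K1 \<epsilon>)))"
  define h2 where "h2 = (\<lambda>\<epsilon> \<theta>. p \<theta> * (F2 (?\<psi> \<epsilon> \<theta>) * (L \<theta> - K1 \<epsilon>)\<^sup>2 - F1 (?\<psi> \<epsilon> \<theta>) * K2 \<epsilon>))"
  have \<psi>: "((\<lambda>\<epsilon>. ?\<psi> \<epsilon> \<theta>) has_real_derivative L \<theta> - K1 \<epsilon>) (at \<epsilon> within {0..<e})"
    if "\<epsilon> \<in> {0..<e}" for \<epsilon> \<theta>
    using K(1)[OF that] by (auto intro!: derivative_eq_intros)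
  have h1: "((\<lambda>\<epsilon>. g \<epsilon> \<theta>) has_real_derivative h1 \<epsilon> \<theta>) (at \<epsilon> within {0..<e})"
    if i: "\<epsilon> \<in> {0..<e}" and s: "\<theta> \<in> S" for \<epsilon> \<theta>
  proof -
    have "((\<lambda>\<epsilon>. p \<theta> * F (?\<psi> \<epsilon> \<theta>)) has_real_derivative h1 \<epsilon> \<theta>) (at \<epsilon> within {0..<e})"
      unfolding h1_def by (intro DERIV_cmult DERIV_chain2[OF F(1) \<psi>] i)
    then show ?thesis
      by (rule has_field_derivative_transform_within[where d=1]) (use i s eq in auto)
  qed
  have h2: "((\<lambda>\<epsilon>. h1 \<epsilon> \<theta>) has_real_derivative h2 \<epsilon> \<theta>) (at \<epsilon> within {0..<e})"
    if i: "\<epsilon> \<in> {0..<e}" for \<epsilon> \<theta>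
    unfolding h1_def h2_def
    by (rule derivative_eq_intros DERIV_chain2[OF F(2) \<psi>] K(2) i refl)+
      (simp add: algebra_simps power2_eq_square)
  note D = diff_under_integral2_explicit[OF g refl h1 h2]
  show "set_integrable M S (g \<epsilon>)" if "\<epsilon> \<in> {0..<e}" for \<epsilon>
    using D(1)[OF _ _ _ that] .
  show "((\<lambda>\<epsilon>. LINT \<theta>:S|M. g \<epsilon> \<theta>) has_real_derivative (LINT \<theta>:S|M. h1 \<epsilon> \<theta>)) (at \<epsilon> within {0..<e})"
    if "\<epsilon> \<in> {0..<e}" for \<epsilon>
    using D(4)[OF _ _ _ that] .
  have 0: "0 \<in> {0..<e}" using e by simp
  \<comment> \<open>The integral of this expression is a multiple of the mean of \<open>L\<close>
    minus \<open>K1 0\<close>, hence 0.\<close>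
  have "h1 0 \<theta> = F1 0 * (p \<theta> * L \<theta> - K1 0 * p \<theta>)" for \<theta>
    by (simp add: h1_def K0 algebra_simps)
  then show "(LINT \<theta>:S|M. h1 0 \<theta>) = 0"
    using p pL by simp
  have "(LINT \<theta>:S|M. g 0 \<theta>) = (LINT \<theta>:S|M. F 0 * p \<theta>)"
    unfolding set_lebesgue_integral_def
    by (intro Bochner_Integration.integral_cong refl) (use eq[OF 0] K0 in \<open>auto simp: indicator_def\<close>)
  then show "(LINT \<theta>:S|M. g 0 \<theta>) = F 0"
    using p by simp
  \<comment> \<open>Expanding the square exposes the moments of order 0, 1 and 2, whose combination
    is the variance \<open>K2 0\<close>.\<close>
  have "h2 0 \<theta> = F2 0 * (p \<theta> * (L \<theta>)\<^sup>2 - 2 * K1 0 * (p \<theta> * L \<theta>) + (K1 0)\<^sup>2 * p \<theta>) - F1 0 * K2 0 * p \<theta>" for \<theta>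
    by (simp add: h2_def K0 algebra_simps power2_eq_square)
  then have "(LINT \<theta>:S|M. h2 0 \<theta>) =
      F2 0 * (K2 0 + (K1 0)\<^sup>2 - 2 * K1 0 * K1 0 + (K1 0)\<^sup>2) - F1 0 * K2 0"
    using p pL pLL by simp
  also have "\<dots> = (F2 0 - F1 0) * K2 0"
    by (simp add: algebra_simps power2_eq_square)
  finally show "((\<lambda>\<epsilon>. LINT \<theta>:S|M. h1 \<epsilon> \<theta>) has_real_derivative (F2 0 - F1 0) * K2 0)
      (at 0 within {0..<e})"
    using D(5)[OF _ _ _ 0] by simp
qed

text \<open>The factor \<open>F2 0 - F1 0\<close> equals 1 for order 1 and
  \<open>a\<^sup>2 - a\<close> otherwise; the prefactor \<open>1 / (a - 1)\<close> of the divergence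
  turns the latter into \<open>a\<close>, so both cases give the same formula.\<close>

lemma renyi_divergence_tilted_second_derivative:
  fixes p L :: "'a \<Rightarrow> real" and K K1 K2 :: "real \<Rightarrow> real"
  assumes e: "0 < e"
    and g: "diff_under_integral2 M S {0..<e} (\<lambda>\<epsilon>. renyi_integrand a (P \<epsilon>) p)"
    and P: "\<And>\<epsilon> \<theta>. \<epsilon> \<in> {0..<e} \<Longrightarrow> \<theta> \<in> S \<Longrightarrow> P \<epsilon> \<theta> = p \<theta> * exp (\<epsilon> * L \<theta> - K \<epsilon>)"
    and p_pos: "\<And>\<theta>. \<theta> \<in> S \<Longrightarrow> 0 < p \<theta>"
    and K: "\<And>\<epsilon>. \<epsilon> \<in> {0..<e} \<Longrightarrow> (K has_real_derivative K1 \<epsilon>) (at \<epsilon> within {0..<e})"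
      "\<And>\<epsilon>. \<epsilon> \<in> {0..<e} \<Longrightarrow> (K1 has_real_derivative K2 \<epsilon>) (at \<epsilon> within {0..<e})"
    and K0: "K 0 = 0"
    and p: "set_integrable M S p" "(LINT \<theta>:S|M. p \<theta>) = 1"
    and pL: "set_integrable M S (\<lambda>\<theta>. p \<theta> * L \<theta>)" "(LINT \<theta>:S|M. p \<theta> * L \<theta>) = K1 0"
    and pLL: "set_integrable M S (\<lambda>\<theta>. p \<theta> * (L \<theta>)\<^sup>2)"
      "(LINT \<theta>:S|M. p \<theta> * (L \<theta>)\<^sup>2) = K2 0 + (K1 0)\<^sup>2"
  shows "has_right_second_derivative (\<lambda>\<epsilon>. renyi_divergence M S a (P \<epsilon>) p) (a * K2 0) 0"
proof (cases "a = 1")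
  case True
  \<comment> \<open>Positivity of \<open>p\<close> on \<open>S\<close> lets the ratio of the two
    densities cancel to the exponential, whose logarithm is the tilt.\<close>
  have eq: "renyi_integrand a (P \<epsilon>) p \<theta> = p \<theta> * ((\<lambda>t. t * exp t) (\<epsilon> * L \<theta> - K \<epsilon>))"
    if "\<epsilon> \<in> {0..<e}" "\<theta> \<in> S" for \<epsilon> \<theta>
    using p_pos[OF that(2)] by (simp add: renyi_integrand_def True P[OF that])
  have F: "((\<lambda>t::real. t * exp t) has_real_derivative (1 + t) * exp t) (at t)"
    "((\<lambda>t::real. (1 + t) * exp t) has_real_derivative (2 + t) * exp t) (at t)" for t
    by (auto intro!: derivative_eq_intros simp: algebra_simps)
  obtain G1 where G: "\<And>\<epsilon>. \<epsilon> \<in> {0..<e} \<Longrightarrow>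
      ((\<lambda>\<epsilon>. LINT \<theta>:S|M. renyi_integrand a (P \<epsilon>) p \<theta>) has_real_derivative G1 \<epsilon>) (at \<epsilon> within {0..<e})"
    "(G1 has_real_derivative ((2 + 0) * exp 0 - (1 + 0) * exp 0) * K2 0) (at 0 within {0..<e})"
    using integral_tilted_second_derivative[OF e g eq F K K0 p pL pLL] by blast
  then show ?thesis
    unfolding has_right_second_derivative_def renyi_divergence_def using e True
    by (intro exI[of _ e] conjI exI[of _ G1]) auto
next
  case False
  have eq: "renyi_integrand a (P \<epsilon>) p \<theta> = p \<theta> * ((\<lambda>t. exp (a * t)) (\<epsilon> * L \<theta> - K \<epsilon>))"
    if "\<epsilon> \<in> {0..<e}" "\<theta> \<in> S" for \<epsilon> \<theta>
  proof -
    have "p \<theta> powr a * p \<theta> powr (1 - a) = p \<theta>"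
      using p_pos[OF that(2)] by (simp flip: powr_add)
    then show ?thesis
      using p_pos[OF that(2)]
      by (simp add: renyi_integrand_def False P[OF that] powr_mult exp_powr_real mult_ac)
  qed
  have F: "((\<lambda>t. exp (a * t)) has_real_derivative a * exp (a * t)) (at t)"
    "((\<lambda>t. a * exp (a * t)) has_real_derivative a\<^sup>2 * exp (a * t)) (at t)" for t
    by (auto intro!: derivative_eq_intros simp: power2_eq_square)
  define G where "G = (\<lambda>\<epsilon>. LINT \<theta>:S|M. renyi_integrand a (P \<epsilon>) p \<theta>)"
  obtain G1 where int: "\<And>\<epsilon>. \<epsilon> \<in> {0..<e} \<Longrightarrow> set_integrable M S (renyi_integrand a (P \<epsilon>) p)"
    and G: "\<And>\<epsilon>. \<epsilon> \<in> {0..<e} \<Longrightarrow> (G has_real_derivative G1 \<epsilon>) (at \<epsilon> within {0..<e})"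
    "(G1 has_real_derivative (a\<^sup>2 * exp (a * 0) - a * exp (a * 0)) * K2 0) (at 0 within {0..<e})"
    "G 0 = exp (a * 0)" "G1 0 = 0"
    unfolding G_def using integral_tilted_second_derivative[OF e g eq F K K0 p pL pLL] by blast
  \<comment> \<open>The logarithm is differentiable only where \<open>G\<close> is positive;
    \<open>p\<close>, with integral 1, shows that \<open>S\<close> is not null.\<close>
  have pos: "0 < G \<epsilon>" if "\<epsilon> \<in> {0..<e}" for \<epsilon>
    unfolding G_def by (rule set_integral_pos[OF int[OF that], where h=p]) (use p p_pos eq that in auto)
  have 0: "0 \<in> {0..<e}" using e by simp
  have 1: "((\<lambda>s. 1 / (a - 1) * ln (G s)) has_real_derivative 1 / (a - 1) * (G1 \<epsilon> / G \<epsilon>)) (at \<epsilon> within {0..<e})"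
    if "\<epsilon> \<in> {0..<e}" for \<epsilon>
  proof -
    have "((\<lambda>s. ln (G s)) has_real_derivative G1 \<epsilon> / G \<epsilon>) (at \<epsilon> within {0..<e})"
      using G(1)[OF that] pos[OF that] by (auto intro!: derivative_eq_intros)
    then show ?thesis by (rule DERIV_cmult)
  qed
  have "((\<lambda>s. 1 / (a - 1) * (G1 s / G s)) has_real_derivative
      1 / (a - 1) * ((a\<^sup>2 * exp (a * 0) - a * exp (a * 0)) * K2 0 / G 0 - (G1 0 / G 0)\<^sup>2)) (at 0 within {0..<e})"
    by (intro DERIV_cmult ln_second_derivative(2) pos 0 G)
  \<comment> \<open>Since \<open>G 0 = 1\<close> and \<open>G1 0 = 0\<close>, taking the logarithm
    does not change the second derivative at 0.\<close>
  also have "1 / (a - 1) * ((a\<^sup>2 * exp (a * 0) - a * exp (a * 0)) * K2 0 / G 0 - (G1 0 / G 0)\<^sup>2) = a * K2 0"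
    using False G(3,4) by (simp add: power2_eq_square field_simps)
  finally have 2: "((\<lambda>s. 1 / (a - 1) * (G1 s / G s)) has_real_derivative a * K2 0) (at 0 within {0..<e})" .
  have "(\<lambda>\<epsilon>. renyi_divergence M S a (P \<epsilon>) p) = (\<lambda>s. 1 / (a - 1) * ln (G s))"
    by (simp add: renyi_divergence_def False G_def)
  then show ?thesis
    unfolding has_right_second_derivative_def using e 1 2
    by (intro exI[of _ e] conjI exI[of _ "\<lambda>s. 1 / (a - 1) * (G1 s / G s)"]) auto
qed

section \<open>The normalizing constant and the posterior of the geometric class\<close>

lemma geom_const_neq_0:
  assumes p: "prob_density M p" "\<And>\<theta>. \<theta> \<in> space M \<Longrightarrow> 0 < p \<theta>"
    and q: "prob_density M q" "\<And>\<theta>. \<theta> \<in> space M \<Longrightarrow> 0 < q \<theta>"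
    and \<epsilon>: "0 \<le> \<epsilon>" "\<epsilon> \<le> 1"
  shows "geom_const M p q \<epsilon> \<noteq> 0"
proof -
  have int: "integrable M p" "integrable M q" and one: "(LINT \<theta>|M. p \<theta>) = 1"
    using p(1) q(1) by (auto simp: prob_density_def)
  have [measurable]: "p \<in> borel_measurable M" "q \<in> borel_measurable M"
    using int by auto
  \<comment> \<open>Weighted AM-GM bounds the geometric mean by a convex combination of the two
    densities. Integrability matters because a non-integrable function has integral 0 by default,
    whose inverse is again 0.\<close>
  have "integrable M (\<lambda>\<theta>. p \<theta> powr (1 - \<epsilon>) * q \<theta> powr \<epsilon>)"
  proof (rule Bochner_Integration.integrable_bound)
    show "integrable M (\<lambda>\<theta>. (1 - \<epsilon>) * p \<theta> + \<epsilon> * q \<theta>)" using int by simp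
    show "AE \<theta> in M. norm (p \<theta> powr (1 - \<epsilon>) * q \<theta> powr \<epsilon>) \<le> norm ((1 - \<epsilon>) * p \<theta> + \<epsilon> * q \<theta>)"
    proof (rule AE_I2)
      fix \<theta> assume "\<theta> \<in> space M"
      then have "p \<theta> powr (1 - \<epsilon>) * q \<theta> powr \<epsilon> \<le> (1 - \<epsilon>) * p \<theta> + \<epsilon> * q \<theta>"
        using \<epsilon> p(2) q(2) by (intro Youngs_inequality_0) auto
      then show "norm (p \<theta> powr (1 - \<epsilon>) * q \<theta> powr \<epsilon>) \<le> norm ((1 - \<epsilon>) * p \<theta> + \<epsilon> * q \<theta>)"
        by simp
    qed
  qed simp
  moreover then have "0 < (LINT \<theta>:space M|M. p \<theta> powr (1 - \<epsilon>) * q \<theta> powr \<epsilon>)"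
  proof (intro set_integral_pos)
    show "0 < p \<theta> powr (1 - \<epsilon>) * q \<theta> powr \<epsilon>" if "\<theta> \<in> space M" for \<theta>
      using p(2)[OF that] q(2)[OF that] by simp
    show "(LINT \<theta>:space M|M. p \<theta>) \<noteq> 0"
      using one int by (simp add: set_integral_space)
  qed (simp add: set_integrable_space)
  ultimately show ?thesis
    by (simp add: geom_const_def set_integral_space)
qed

lemma posterior_geom_prior:
  assumes "geom_const M \<pi>0 q \<epsilon> \<noteq> 0"
  shows "posterior M f x (geom_prior M \<pi>0 q \<epsilon>) \<theta> =
    f \<theta> x * \<pi>0 \<theta> powr (1 - \<epsilon>) * q \<theta> powr \<epsilon> / (LINT \<theta>|M. f \<theta> x * \<pi>0 \<theta> powr (1 - \<epsilon>) * q \<theta> powr \<epsilon>)"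
proof -
  have "prior_predictive M f x (geom_prior M \<pi>0 q \<epsilon>) =
      (LINT \<theta>|M. geom_const M \<pi>0 q \<epsilon> * (f \<theta> x * \<pi>0 \<theta> powr (1 - \<epsilon>) * q \<theta> powr \<epsilon>))"
    by (simp add: prior_predictive_def geom_prior_def mult_ac)
  with assms show ?thesis
    by (simp add: posterior_def geom_prior_def)
qed

section \<open>Curvature at 0 in the geometric contaminated class\<close>

theorem theorem2:
  fixes M :: "'t measure" and N :: "'x measure"
    and f :: "'t \<Rightarrow> 'x \<Rightarrow> real" and x :: 'x
    and \<pi>0 q :: "'t \<Rightarrow> real" and Q :: "('t \<Rightarrow> real) set"
    and a \<epsilon>0 :: real
  assumes model: "\<And>\<theta>. \<theta> \<in> space M \<Longrightarrow> prob_density N (f \<theta>)" and data: "x \<in> space N"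
    and order: "a > 0"
    and prior: "prob_density M \<pi>0" and prior_pos: "\<And>\<theta>. \<theta> \<in> space M \<Longrightarrow> \<pi>0 \<theta> > 0"
    and contaminating_class: "\<And>p. p \<in> Q \<Longrightarrow> prob_density M p"
    and q: "q \<in> Q" and q_pos: "\<And>\<theta>. \<theta> \<in> space M \<Longrightarrow> q \<theta> > 0"
    and m_prior: "integrable M (\<lambda>\<theta>. f \<theta> x * \<pi>0 \<theta>)" "prior_predictive M f x \<pi>0 > 0"
    and m_q: "integrable M (\<lambda>\<theta>. f \<theta> x * q \<theta>)" "prior_predictive M f x q > 0"
    and eps0: "0 < \<epsilon>0" "\<epsilon>0 \<le> 1"
    and regular: "geom_regular M f x \<pi>0 q a {0..<\<epsilon>0}"
  shows "has_right_second_derivative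
           (\<lambda>\<epsilon>. renyi_divergence M (likelihood_support M f x) a
                  (posterior M f x (geom_prior M \<pi>0 q \<epsilon>)) (posterior M f x \<pi>0))
           (a * prob_space.variance (density M (\<lambda>\<theta>. ennreal (posterior M f x \<pi>0 \<theta>)))
                  (\<lambda>\<theta>. ln (q \<theta> / \<pi>0 \<theta>)))
           0"
proof -
  let ?I = "{0..<\<epsilon>0}"
  define S where "S = likelihood_support M f x"
  define L where "L = (\<lambda>\<theta>. ln (q \<theta> / \<pi>0 \<theta>))"
  define w where "w = (\<lambda>\<epsilon> \<theta>. f \<theta> x * \<pi>0 \<theta> powr (1 - \<epsilon>) * q \<theta> powr \<epsilon>)"
  define Z where "Z = (\<lambda>\<epsilon>. LINT \<theta>:space M|M. w \<epsilon> \<theta>)"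
  define Z1 where "Z1 = (\<lambda>\<epsilon>. LINT \<theta>:space M|M. w \<epsilon> \<theta> * L \<theta>)"
  define Z2 where "Z2 = (\<lambda>\<epsilon>. LINT \<theta>:space M|M. w \<epsilon> \<theta> * (L \<theta>)\<^sup>2)"
  define p where "p = posterior M f x \<pi>0"
  define m where "m = prior_predictive M f x \<pi>0"
  have I0: "0 \<in> ?I" using eps0 by simp
  have m: "0 < m" using m_prior(2) by (simp add: m_def)
  have S: "S \<subseteq> space M" "\<And>\<theta>. \<theta> \<in> S \<Longrightarrow> 0 < f \<theta> x"
    by (auto simp: S_def likelihood_support_def)
  \<comment> \<open>The model density is nonnegative at the data, so outside the support it is
    exactly 0, and integrals weighted by it agree over \<open>S\<close> and over the whole
    space.\<close>
  have f0: "f \<theta> x = 0" if "\<theta> \<in> space M" "\<theta> \<notin> S" for \<theta>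
    using model[OF that(1)] data that by (force simp: prob_density_def S_def likelihood_support_def)
  have qd: "prob_density M q" using contaminating_class[OF q] .
  have int: "integrable M \<pi>0" "integrable M q"
    using prior qd by (auto simp: prob_density_def)
  have [measurable]: "\<pi>0 \<in> borel_measurable M" "q \<in> borel_measurable M"
    "(\<lambda>\<theta>. f \<theta> x * \<pi>0 \<theta>) \<in> borel_measurable M"
    using int m_prior(1) by auto
  have L_meas[measurable]: "L \<in> borel_measurable M" unfolding L_def by measurable
  have p_eq: "p \<theta> = f \<theta> x * \<pi>0 \<theta> / m" for \<theta>
    by (simp add: p_def posterior_def m_def)
  have p_meas[measurable]: "p \<in> borel_measurable M" unfolding p_eq by measurable
  have p_pos: "0 < p \<theta>" if "\<theta> \<in> S" for \<theta>
    using S that prior_pos m by (auto simp: p_eq)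
  have p_0: "p \<theta> = 0" if "\<theta> \<in> space M" "\<theta> \<notin> S" for \<theta>
    using f0[OF that] by (simp add: p_eq)

  \<comment> \<open>The geometric mean is
    \<open>\<pi>0 \<theta> * exp (\<epsilon> * L \<theta>)\<close>, and the likelihood times
    \<open>\<pi>0\<close> is \<open>m * p \<theta>\<close>.\<close>
  have w_exp: "w \<epsilon> \<theta> = m * p \<theta> * exp (\<epsilon> * L \<theta>)" if "\<theta> \<in> space M" for \<epsilon> \<theta>
    using prior_pos[OF that] q_pos[OF that] m
    by (simp add: w_def p_eq L_def powr_def ln_div exp_diff exp_add left_diff_distrib right_diff_distrib
        exp_minus field_simps flip: exp_add)
  have w1: "((\<lambda>\<epsilon>. w \<epsilon> \<theta>) has_real_derivative w \<epsilon> \<theta> * L \<theta>) (at \<epsilon> within ?I)" if "\<theta> \<in> space M" for \<epsilon> \<theta>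
    unfolding w_exp[OF that] by (auto intro!: derivative_eq_intros)
  have w2: "((\<lambda>\<epsilon>. w \<epsilon> \<theta> * L \<theta>) has_real_derivative w \<epsilon> \<theta> * (L \<theta>)\<^sup>2) (at \<epsilon> within ?I)" if "\<theta> \<in> space M" for \<epsilon> \<theta>
    unfolding w_exp[OF that] by (auto intro!: derivative_eq_intros simp: power2_eq_square)
  have wd: "diff_under_integral2 M (space M) ?I w"
    and rd: "diff_under_integral2 M S ?I (\<lambda>\<epsilon>. renyi_integrand a (posterior M f x (geom_prior M \<pi>0 q \<epsilon>)) p)"
    using regular by (auto simp: geom_regular_def w_def S_def p_def)
  note W = diff_under_integral2_explicit[OF wd refl w1 w2]
  have Z1: "(Z has_real_derivative Z1 \<epsilon>) (at \<epsilon> within ?I)"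
    and Z2: "(Z1 has_real_derivative Z2 \<epsilon>) (at \<epsilon> within ?I)" if "\<epsilon> \<in> ?I" for \<epsilon>
    unfolding Z_def Z1_def Z2_def using W(4,5)[OF _ _ that] by blast+

  \<comment> \<open>Posterior moments are integrals against \<open>w 0\<close> divided by
    \<open>m\<close>. Taking \<open>u\<close> as 1, \<open>L\<close> and the square of
    \<open>L\<close> yields the three moments from \<open>Z\<close>, \<open>Z1\<close> and
    \<open>Z2\<close> at 0.\<close>
  have S_int: "set_integrable M S (\<lambda>\<theta>. p \<theta> * u \<theta>) \<longleftrightarrow> set_integrable M (space M) (\<lambda>\<theta>. w 0 \<theta> * u \<theta>)"
    "(LINT \<theta>:S|M. p \<theta> * u \<theta>) = (LINT \<theta>:space M|M. w 0 \<theta> * u \<theta>) / m"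
    "(LINT \<theta>|M. p \<theta> * u \<theta>) = (LINT \<theta>:space M|M. w 0 \<theta> * u \<theta>) / m" for u :: "'t \<Rightarrow> real"
  proof -
    have e: "indicator S \<theta> *\<^sub>R (p \<theta> * u \<theta>) = 1 / m * (indicator (space M) \<theta> *\<^sub>R (w 0 \<theta> * u \<theta>))"
      "p \<theta> * u \<theta> = 1 / m * (indicator (space M) \<theta> *\<^sub>R (w 0 \<theta> * u \<theta>))"
      if "\<theta> \<in> space M" for \<theta>
      using that p_0[OF that] w_exp[OF that] m by (auto simp: indicator_def)
    have "set_integrable M S (\<lambda>\<theta>. p \<theta> * u \<theta>) \<longleftrightarrow>
        integrable M (\<lambda>\<theta>. 1 / m * (indicator (space M) \<theta> *\<^sub>R (w 0 \<theta> * u \<theta>)))"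
      unfolding set_integrable_def by (rule Bochner_Integration.integrable_cong) (use e in auto)
    then show "set_integrable M S (\<lambda>\<theta>. p \<theta> * u \<theta>) \<longleftrightarrow> set_integrable M (space M) (\<lambda>\<theta>. w 0 \<theta> * u \<theta>)"
      using m unfolding set_integrable_def by (subst (asm) integrable_mult_left_iff) auto
    have "(LINT \<theta>:S|M. p \<theta> * u \<theta>) = (LINT \<theta>|M. 1 / m * (indicator (space M) \<theta> *\<^sub>R (w 0 \<theta> * u \<theta>)))"
      unfolding set_lebesgue_integral_def by (rule Bochner_Integration.integral_cong) (use e in auto)
    then show "(LINT \<theta>:S|M. p \<theta> * u \<theta>) = (LINT \<theta>:space M|M. w 0 \<theta> * u \<theta>) / m"
      by (simp add: set_lebesgue_integral_def)
    have "(LINT \<theta>|M. p \<theta> * u \<theta>) = (LINT \<theta>|M. 1 / m * (indicator (space M) \<theta> *\<^sub>R (w 0 \<theta> * u \<theta>)))"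
      by (rule Bochner_Integration.integral_cong) (use e in auto)
    then show "(LINT \<theta>|M. p \<theta> * u \<theta>) = (LINT \<theta>:space M|M. w 0 \<theta> * u \<theta>) / m"
      by (simp add: set_lebesgue_integral_def)
  qed
  have Z0: "Z 0 = m"
    unfolding Z_def m_def prior_predictive_def set_lebesgue_integral_def
    by (rule Bochner_Integration.integral_cong) (use w_exp m in \<open>auto simp: p_eq\<close>)
  have pi: "set_integrable M S p" "(LINT \<theta>:S|M. p \<theta>) = 1"
    using S_int(1,2)[of "\<lambda>_. 1"] W(1)[OF _ _ I0] Z0 m by (auto simp: Z_def)
  have pL: "set_integrable M S (\<lambda>\<theta>. p \<theta> * L \<theta>)" "(LINT \<theta>:S|M. p \<theta> * L \<theta>) = Z1 0 / Z 0"
    using S_int(1,2)[of L] W(2)[OF _ _ I0] Z0 by (auto simp: Z1_def)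
  have pLL: "set_integrable M S (\<lambda>\<theta>. p \<theta> * (L \<theta>)\<^sup>2)" "(LINT \<theta>:S|M. p \<theta> * (L \<theta>)\<^sup>2) = Z2 0 / Z 0"
    using S_int(1,2)[of "\<lambda>\<theta>. (L \<theta>)\<^sup>2"] W(3)[OF _ _ I0] Z0 by (auto simp: Z2_def)

  have Z_pos: "0 < Z \<epsilon>" if "\<epsilon> \<in> ?I" for \<epsilon>
  proof -
    have wi: "integrable M (w \<epsilon>)"
      using W(1)[OF _ _ that] by (simp add: set_integrable_space)
    have e: "indicator S \<theta> *\<^sub>R w \<epsilon> \<theta> = w \<epsilon> \<theta>" if "\<theta> \<in> space M" for \<theta>
      using p_0[OF that] w_exp[OF that] by (auto simp: indicator_def)
    have si: "set_integrable M S (w \<epsilon>)"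
      unfolding set_integrable_def
      by (rule Bochner_Integration.integrable_cong[THEN iffD2, OF refl e wi])
    have "Z \<epsilon> = (LINT \<theta>:S|M. w \<epsilon> \<theta>)"
      using e unfolding Z_def set_lebesgue_integral_def
      by (intro Bochner_Integration.integral_cong) auto
    \<comment> \<open>On \<open>S\<close> the function \<open>w \<epsilon>\<close> is positive, and
      \<open>S\<close> is not null because \<open>p\<close> has integral 1 over it.\<close>
    also have "0 < (LINT \<theta>:S|M. w \<epsilon> \<theta>)"
      by (rule set_integral_pos[OF si, where h=p]) (use pi p_pos m w_exp in auto)
    finally show ?thesis .
  qed
  \<comment> \<open>Subtracting \<open>ln m\<close>, which is \<open>ln (Z 0)\<close>, makes
    \<open>K 0 = 0\<close>, and \<open>exp (- K \<epsilon>)\<close> is the ratio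
    \<open>m / Z \<epsilon>\<close> that normalizes the tilted posterior.\<close>
  define K where "K = (\<lambda>\<epsilon>. ln (Z \<epsilon>) - ln m)"
  define K1 where "K1 = (\<lambda>\<epsilon>. Z1 \<epsilon> / Z \<epsilon>)"
  define K2 where "K2 = (\<lambda>\<epsilon>. Z2 \<epsilon> / Z \<epsilon> - (Z1 \<epsilon> / Z \<epsilon>)\<^sup>2)"
  have K1: "(K has_real_derivative K1 \<epsilon>) (at \<epsilon> within ?I)"
    and K2: "(K1 has_real_derivative K2 \<epsilon>) (at \<epsilon> within ?I)" if "\<epsilon> \<in> ?I" for \<epsilon>
    using DERIV_diff[OF ln_second_derivative(1) DERIV_const, OF Z_pos Z1 Z2, OF that that that, of "ln m"]
      ln_second_derivative(2)[OF Z_pos Z1 Z2, OF that that that]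
    by (simp_all add: K_def K1_def K2_def)
  have P: "posterior M f x (geom_prior M \<pi>0 q \<epsilon>) \<theta> = p \<theta> * exp (\<epsilon> * L \<theta> - K \<epsilon>)"
    if "\<epsilon> \<in> ?I" "\<theta> \<in> S" for \<epsilon> \<theta>
  proof -
    have s: "\<theta> \<in> space M" using S that by auto
    have Zi: "(LINT \<theta>|M. f \<theta> x * \<pi>0 \<theta> powr (1 - \<epsilon>) * q \<theta> powr \<epsilon>) = Z \<epsilon>"
      unfolding Z_def w_def set_lebesgue_integral_def
      by (rule Bochner_Integration.integral_cong) auto
    \<comment> \<open>The constant must be nonzero to cancel; the bound
      \<open>\<epsilon>0 \<le> 1\<close> keeps both exponents nonnegative.\<close>
    have "geom_const M \<pi>0 q \<epsilon> \<noteq> 0"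
      using that eps0 by (intro geom_const_neq_0 prior prior_pos qd q_pos) auto
    then have "posterior M f x (geom_prior M \<pi>0 q \<epsilon>) \<theta> = w \<epsilon> \<theta> / Z \<epsilon>"
      by (simp add: posterior_geom_prior Zi w_def)
    then show ?thesis
      using Z_pos[OF that(1)] m w_exp[OF s, of \<epsilon>] by (simp add: K_def exp_diff)
  qed
  have "has_right_second_derivative
      (\<lambda>\<epsilon>. renyi_divergence M S a (posterior M f x (geom_prior M \<pi>0 q \<epsilon>)) p) (a * K2 0) 0"
    by (rule renyi_divergence_tilted_second_derivative[OF eps0(1) rd P p_pos K1 K2 _ pi pL(1) _ pLL(1)])
      (use pL(2) pLL(2) Z0 in \<open>auto simp: K_def K1_def K2_def\<close>)
  moreover have "prob_space.variance (density M (\<lambda>\<theta>. ennreal (p \<theta>))) L = K2 0"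
  proof -
    \<comment> \<open>Expectations under the posterior measure become integrals over
      \<open>S\<close>, since both equal the same integral against \<open>w 0\<close> divided by
      \<open>m\<close>.\<close>
    have dens: "(LINT \<theta>|density M (\<lambda>\<theta>. ennreal (p \<theta>)). u \<theta>) = (LINT \<theta>:S|M. p \<theta> * u \<theta>)"
      if [measurable]: "u \<in> borel_measurable M" for u :: "'t \<Rightarrow> real"
    proof -
      have "AE \<theta> in M. 0 \<le> p \<theta>"
        using p_pos p_0 by (intro AE_I2) (metis less_eq_real_def)
      then show ?thesis
        using S_int(2,3)[of u] by (subst integral_density) auto
    qed
    have mean: "(LINT \<theta>|density M (\<lambda>\<theta>. ennreal (p \<theta>)). L \<theta>) = K1 0"
      using dens[OF L_meas] pL(2) by (simp add: K1_def)
    \<comment> \<open>The variance is the second moment minus the squared mean, which is how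
      \<open>K2 0\<close> was defined from \<open>Z\<close>, \<open>Z1\<close> and
      \<open>Z2\<close>.\<close>
    have "p \<theta> * (L \<theta> - K1 0)\<^sup>2 = p \<theta> * (L \<theta>)\<^sup>2 - 2 * K1 0 * (p \<theta> * L \<theta>) + (K1 0)\<^sup>2 * p \<theta>" for \<theta>
      by (simp add: algebra_simps power2_eq_square)
    then have "(LINT \<theta>:S|M. p \<theta> * (L \<theta> - K1 0)\<^sup>2) = Z2 0 / Z 0 - 2 * K1 0 * K1 0 + (K1 0)\<^sup>2"
      using pi pL pLL by (simp add: K1_def)
    also have "\<dots> = K2 0"
      by (simp add: K1_def K2_def power2_eq_square)
    finally show ?thesis
      unfolding mean by (subst dens) auto
  qed
  ultimately show ?thesis
    unfolding S_def p_def L_def by simp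
qed

end
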